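(* For every $n\ge 0$, the map $\Xi$ is a bijection between square symmetric tableaux of size $2n+1$ and ordered partitions of $\{1,\ldots,n\}$. Moreover, if $T$ has $j$ diagonal crossings and $\pi=\Xi(T)$, then $\pi$ has $j$ blocks.
   Context: A Ferrers diagram is a finite set of unit cells of $\mathbb{Z}^2$ forming left-justified rows whose lengths weakly decrease from top to bottom, considered up to translation. A tree-like tableau is a Ferrers diagram in which each cell is empty or pointed, such that: (1) the top-left cell is pointed; (2) every non-root pointed cell has either a pointed cell above it in its column or a pointed cell to its left in its row, but not both; (3) every row and column contains a pointed cell. Its size is its number of points (half-perimeter minus 1). A symmetric tableau is a tree-like tableau invariant under reflection through the main diagonal; it is square if its shape is a square, so a square symmetric tableau of size $2n+1$ has shape $(n+1)\times(n+1)$. A crossing is an empty cell with a pointed cell above it in its column and a pointed cell to its left in its row; a diagonal crossing is a crossing lying on the main diagonal (row $i$, column $i$). An ordered partition of $\{1,\ldots,n\}$ is a set partition into blocks together with a linear order on the blocks. The half tableau of a square symmetric tableau of size $2n+1$ is the set of its cells strictly below the diagonal (with their points): it has $n$ rows, with $1,2,\ldots,n$ cells from top to bottom, and $n$ points, and determines the tableau. $\Xi$ is defined on half tableaux recursively ($\Xi$ of the empty half tableau, $n=0$, is the empty ordered partition). Let $T$ be a half tableau with $n$ rows; label column positions $1,\ldots,n$ from left to right. Let $B=\{i_1<\cdots<i_m\}$ be the positions of the points in the last row (there is at least one). For $j>1$, column $i_j$ contains no point other than the one in the last row and row $i_j-1$ is empty; delete these rows and columns for all $j>1$ together with the last row,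 and left- and bottom-justify the remaining cells: this gives a half tableau $T'$ with $n-m$ points. Let $\Xi(T')=(B'_1,\ldots,B'_\ell)$, an ordered partition of $\{1,\ldots,n-m\}$; relabel its entries by the unique increasing bijection $\{1,\ldots,n-m\}\to\{1,\ldots,n\}\setminus B$, obtaining blocks $B_1,\ldots,B_\ell$. Then $\Xi(T)=(B_1,\ldots,B_\ell,B)$. $\Xi$ of a square symmetric tableau is $\Xi$ of its half tableau. *)

theory Defs
  imports Main "HOL-Library.Disjoint_Sets"
begin

text \<open>
  Cells are pairs (row, column), counted from 1, rows from top to bottom. Diagrams are
  considered up to translation, so the top-left cell is fixed to be (1, 1).
\<close>

type_synonym cell = "nat \<times> nat"

datatype tableau = Tableau (cells: "cell set") (points: "cell set")

definition ferrers_diagram :: "cell set \<Rightarrow> bool" where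
  "ferrers_diagram D \<longleftrightarrow> finite D \<and>
     (\<exists>len :: nat \<Rightarrow> nat. (\<forall>i\<ge>1. len (i + 1) \<le> len i) \<and>
        D = {(i, j). 1 \<le> i \<and> 1 \<le> j \<and> j \<le> len i})"

definition point_above :: "tableau \<Rightarrow> cell \<Rightarrow> bool" where
  "point_above T c \<longleftrightarrow> (\<exists>i < fst c. (i, snd c) \<in> points T)"

definition point_left :: "tableau \<Rightarrow> cell \<Rightarrow> bool" where
  "point_left T c \<longleftrightarrow> (\<exists>j < snd c. (fst c, j) \<in> points T)"

text \<open>The inequality of truth values below is the exclusive or.\<close>

definition tree_like_tableau :: "tableau \<Rightarrow> bool" where
  "tree_like_tableau T \<longleftrightarrow>
     ferrers_diagram (cells T) \<and> points T \<subseteq> cells T \<and>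
     (1, 1) \<in> points T \<and>
     (\<forall>c \<in> points T - {(1, 1)}. point_above T c \<noteq> point_left T c) \<and>
     (\<forall>(i, j) \<in> cells T. (\<exists>j'. (i, j') \<in> points T) \<and> (\<exists>i'. (i', j) \<in> points T))"

definition tableau_size :: "tableau \<Rightarrow> nat" where
  "tableau_size T = card (points T)"

definition symmetric_tableau :: "tableau \<Rightarrow> bool" where
  "symmetric_tableau T \<longleftrightarrow> tree_like_tableau T \<and>
     prod.swap ` cells T = cells T \<and> prod.swap ` points T = points T"

definition square_shape :: "tableau \<Rightarrow> bool" where
  "square_shape T \<longleftrightarrow> (\<exists>k. cells T = {1..k} \<times> {1..k})"

definition square_symmetric_tableaux :: "nat \<Rightarrow> tableau set" where
  "square_symmetric_tableaux s = {T. symmetric_tableau T \<and> square_shape T \<and> tableau_size T = s}"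

definition crossing :: "tableau \<Rightarrow> cell \<Rightarrow> bool" where
  "crossing T c \<longleftrightarrow> c \<in> cells T - points T \<and> point_above T c \<and> point_left T c"

definition diagonal_crossings :: "tableau \<Rightarrow> cell set" where
  "diagonal_crossings T = {(i, j). i = j \<and> crossing T (i, j)}"

definition ordered_partitions :: "nat \<Rightarrow> nat set list set" where
  "ordered_partitions n = {bs. distinct bs \<and> partition_on {1..n} (set bs)}"

text \<open>
  A half tableau with \<open>n\<close> rows is given by \<open>n\<close> and its set of points \<open>H\<close>; its cells are the
  \<open>(r, c)\<close> with \<open>1 \<le> c \<le> r \<le> n\<close>. Row \<open>r\<close> of the half tableau is the part below the diagonal
  of row \<open>r + 1\<close> of the tableau.
\<close>

definition half_points :: "tableau \<Rightarrow> cell set" where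
  "half_points T = {(r, c). c \<le> r \<and> (r + 1, c) \<in> points T}"

definition last_row :: "nat \<Rightarrow> cell set \<Rightarrow> nat set" where
  "last_row n H = {c \<in> {1..n}. (n, c) \<in> H}"

text \<open>
  Deleting the last row, and for each \<open>i \<in> B\<close> other than the smallest one the column \<open>i\<close> and the
  row \<open>i - 1\<close>. Justifying the remaining cells renumbers each remaining row and column by its
  rank among the remaining ones.
\<close>

definition contract :: "nat \<Rightarrow> nat set \<Rightarrow> cell set \<Rightarrow> cell set" where
  "contract n B H =
     (let C = B - {Min B}; R = (\<lambda>i. i - 1) ` C in
       {(card ({1..r} - R), card ({1..c} - C)) | r c.
          (r, c) \<in> H \<and> r < n \<and> r \<notin> R \<and> c \<notin> C})"

text \<open>The increasing bijection from \<open>{1..n - card B}\<close> onto \<open>{1..n} - B\<close>, for \<open>B \<subseteq> {1..n}\<close>.\<close>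

definition relabel :: "nat \<Rightarrow> nat set \<Rightarrow> nat \<Rightarrow> nat" where
  "relabel n B k = sorted_list_of_set ({1..n} - B) ! (k - 1)"

text \<open>
  The last row of a half tableau with \<open>n > 0\<close> rows is never empty; the value in that case is
  only there to make the recursion total.
\<close>

function half_Xi :: "nat \<Rightarrow> cell set \<Rightarrow> nat set list" where
  "half_Xi n H =
     (if n = 0 \<or> last_row n H = {} then []
      else let B = last_row n H in
        map (\<lambda>b. relabel n B ` b) (half_Xi (n - card B) (contract n B H)) @ [B])"
  by pat_completeness auto
termination
  by (relation "measure fst") (auto simp: last_row_def card_gt_0_iff)

declare half_Xi.simps [simp del]

text \<open>A square symmetric tableau of size \<open>2 * n + 1\<close> has a half tableau with \<open>n\<close> rows.\<close>

definition Xi :: "tableau \<Rightarrow> nat set list" where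
  "Xi T = half_Xi ((tableau_size T - 1) div 2) (half_points T)"

end

theory Submission
  imports Defs
begin

text \<open>
  Write row \<open>r\<close> of a half tableau as row \<open>r + 1\<close>, so that rows and columns are both indexed by
  \<open>X = {1..n + 1}\<close>, as in the full tableau. Deleting column \<open>i\<close> together with row \<open>i - 1\<close> then
  deletes the index \<open>i\<close> from \<open>X\<close>, and justifying is an order isomorphism onto an initial segment.
  Let \<open>B\<close> be the last row. A point in column \<open>i \<in> B - {Min B}\<close> of the last row has a point to its
  left, hence none above it, even in the reflected half: so column \<open>i\<close> is otherwise empty, and so is
  row \<open>i\<close>. Thus a half tableau is recovered from \<open>B\<close> and its contraction; conversely, inserting any
  nonempty \<open>B\<close> gives a half tableau. This is the recursion satisfied by ordered partitions with
  last block \<open>B\<close>. Each step removes exactly one nonempty row of the half tableau, and by symmetry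
  nonempty rows correspond to diagonal crossings.
\<close>

section \<open>Half tableaux on an arbitrary index set\<close>

text \<open>
  The points strictly below the diagonal of a square symmetric tableau with rows and columns indexed
  by \<open>X\<close>. The root lies in column \<open>j\<close> if \<open>j = Min X\<close>, and a point \<open>(j, j')\<close> reflects to the
  point \<open>(j', j)\<close> in column \<open>j\<close>, so the three disjuncts say that \<open>(i, j)\<close> has a point above it.
\<close>

definition htab :: "nat set \<Rightarrow> cell set \<Rightarrow> bool" where
  "htab X P \<longleftrightarrow>
     (\<forall>i j. (i, j) \<in> P \<longrightarrow> i \<in> X \<and> j \<in> X \<and> j < i) \<and>
     (\<forall>i j. (i, j) \<in> P \<longrightarrow>
        ((\<forall>x\<in>X. j \<le> x) \<or> (\<exists>i'<i. (i', j) \<in> P) \<or> (\<exists>j'. (j, j') \<in> P)) \<noteq> (\<exists>j'<j. (i, j') \<in> P)) \<and>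
     (\<forall>x\<in>X. (\<forall>y\<in>X. x \<le> y) \<or> (\<exists>y. (x, y) \<in> P \<or> (y, x) \<in> P))"

lemma htabD:
  assumes "htab X P"
  shows "(i, j) \<in> P \<Longrightarrow> i \<in> X" "(i, j) \<in> P \<Longrightarrow> j \<in> X" "(i, j) \<in> P \<Longrightarrow> j < i"
    and "(i, j) \<in> P \<Longrightarrow>
       ((\<forall>x\<in>X. j \<le> x) \<or> (\<exists>i'<i. (i', j) \<in> P) \<or> (\<exists>j'. (j, j') \<in> P)) \<noteq> (\<exists>j'<j. (i, j') \<in> P)"
    and "x \<in> X \<Longrightarrow> (\<forall>y\<in>X. x \<le> y) \<or> (\<exists>y. (x, y) \<in> P \<or> (y, x) \<in> P)"
proof -
  note h = assms[unfolded htab_def]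
  note inside = conjunct1[OF h, rule_format]
  show "(i, j) \<in> P \<Longrightarrow> i \<in> X" "(i, j) \<in> P \<Longrightarrow> j \<in> X" "(i, j) \<in> P \<Longrightarrow> j < i"
    using inside by simp_all
  show "(i, j) \<in> P \<Longrightarrow>
      ((\<forall>x\<in>X. j \<le> x) \<or> (\<exists>i'<i. (i', j) \<in> P) \<or> (\<exists>j'. (j, j') \<in> P)) \<noteq> (\<exists>j'<j. (i, j') \<in> P)"
    by (rule h[THEN conjunct2, THEN conjunct1, rule_format])
  show "x \<in> X \<Longrightarrow> (\<forall>y\<in>X. x \<le> y) \<or> (\<exists>y. (x, y) \<in> P \<or> (y, x) \<in> P)"
    by (rule h[THEN conjunct2, THEN conjunct2, rule_format])
qed

lemma htabI:
  assumes "\<And>i j. (i, j) \<in> P \<Longrightarrow> i \<in> X \<and> j \<in> X \<and> j < i"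
    and "\<And>i j. (i, j) \<in> P \<Longrightarrow>
       ((\<forall>x\<in>X. j \<le> x) \<or> (\<exists>i'<i. (i', j) \<in> P) \<or> (\<exists>j'. (j, j') \<in> P)) \<noteq> (\<exists>j'<j. (i, j') \<in> P)"
    and "\<And>x. x \<in> X \<Longrightarrow> (\<forall>y\<in>X. x \<le> y) \<or> (\<exists>y. (x, y) \<in> P \<or> (y, x) \<in> P)"
  shows "htab X P"
  unfolding htab_def by (rule conjI conjI allI impI ballI assms | assumption)+

text \<open>\<open>htab\<close> refers to indices only through their order and through membership,
  and a strictly increasing map preserves and reflects both. This makes the renumbering done by
  \<open>contract\<close> harmless.\<close>

lemma htab_image:
  fixes f :: "nat \<Rightarrow> nat"
  assumes f: "strict_mono_on X f" and P: "P \<subseteq> X \<times> X"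
  shows "htab (f ` X) (map_prod f f ` P) \<longleftrightarrow> htab X P"
proof -
  have less: "f x < f y \<longleftrightarrow> x < y" and le: "f x \<le> f y \<longleftrightarrow> x \<le> y" if "x \<in> X" "y \<in> X" for x y
    using strict_mono_on_less[OF f] strict_mono_on_less_eq[OF f] that by auto
  have inj: "inj_on f X" using f strict_mono_on_imp_inj_on by blast
  have mem: "(f i, f j) \<in> map_prod f f ` P \<longleftrightarrow> (i, j) \<in> P" if "i \<in> X" "j \<in> X" for i j
    using inj_on_image_mem_iff[OF map_prod_inj_on[OF inj inj], of "(i, j)" P] that P by simp
  have sub: "i \<in> X \<and> j \<in> X" if "(i, j) \<in> P" for i j
    using P that by auto
  have sub': "x \<in> f ` X \<and> y \<in> f ` X" if "(x, y) \<in> map_prod f f ` P" for x y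
    using P that by auto
  \<comment> \<open>The predicate \<open>R\<close> stays general: \<open>True\<close> yields the
    whole row, a bound on \<open>z\<close> yields the points to the left. \<open>col'\<close> treats
    columns likewise.\<close>
  have row': "(\<exists>z. R z \<and> (f i, z) \<in> map_prod f f ` P) \<longleftrightarrow> (\<exists>z\<in>X. R (f z) \<and> (i, z) \<in> P)"
    if "i \<in> X" for i R
  proof
    assume "\<exists>z. R z \<and> (f i, z) \<in> map_prod f f ` P"
    then obtain z where z: "R z" "(f i, z) \<in> map_prod f f ` P" by (elim exE conjE)
    obtain b where "b \<in> X" "z = f b" using sub'[OF z(2)] by (elim conjE imageE)
    then have "R (f b)" "(i, b) \<in> P" using z mem[OF that, of b] by simp_all
    then show "\<exists>z\<in>X. R (f z) \<and> (i, z) \<in> P" using \<open>b \<in> X\<close> by blast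
  next
    assume "\<exists>z\<in>X. R (f z) \<and> (i, z) \<in> P"
    then obtain z where z: "z \<in> X" "R (f z)" "(i, z) \<in> P" by (elim bexE conjE)
    then have "(f i, f z) \<in> map_prod f f ` P" using mem[OF that z(1)] by simp
    with z(2) show "\<exists>z. R z \<and> (f i, z) \<in> map_prod f f ` P" by (intro exI[of _ "f z"] conjI)
  qed
  have col': "(\<exists>z. R z \<and> (z, f i) \<in> map_prod f f ` P) \<longleftrightarrow> (\<exists>z\<in>X. R (f z) \<and> (z, i) \<in> P)"
    if "i \<in> X" for i R
  proof
    assume "\<exists>z. R z \<and> (z, f i) \<in> map_prod f f ` P"
    then obtain z where z: "R z" "(z, f i) \<in> map_prod f f ` P" by (elim exE conjE)
    obtain b where "b \<in> X" "z = f b" using sub'[OF z(2)] by (elim conjE imageE)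
    then have "R (f b)" "(b, i) \<in> P" using z mem[OF _ that, of b] by simp_all
    then show "\<exists>z\<in>X. R (f z) \<and> (z, i) \<in> P" using \<open>b \<in> X\<close> by blast
  next
    assume "\<exists>z\<in>X. R (f z) \<and> (z, i) \<in> P"
    then obtain z where z: "z \<in> X" "R (f z)" "(z, i) \<in> P" by (elim bexE conjE)
    then have "(f z, f i) \<in> map_prod f f ` P" using mem[OF z(1) that] by simp
    with z(2) show "\<exists>z. R z \<and> (z, f i) \<in> map_prod f f ` P" by (intro exI[of _ "f z"] conjI)
  qed
  have row: "(\<exists>z. (f i, z) \<in> map_prod f f ` P) \<longleftrightarrow> (\<exists>z. (i, z) \<in> P)" if "i \<in> X" for i
    using row'[OF that, of "\<lambda>_. True"] sub by auto
  have col: "(\<exists>z. (z, f i) \<in> map_prod f f ` P) \<longleftrightarrow> (\<exists>z. (z, i) \<in> P)" if "i \<in> X" for i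
    using col'[OF that, of "\<lambda>_. True"] sub by auto
  have left: "(\<exists>z<f j. (f i, z) \<in> map_prod f f ` P) \<longleftrightarrow> (\<exists>z<j. (i, z) \<in> P)"
    if "i \<in> X" "j \<in> X" for i j
    unfolding row'[OF that(1), of "\<lambda>z. z < f j"] using less[OF _ that(2)] sub by auto
  have above: "(\<exists>z<f i. (z, f j) \<in> map_prod f f ` P) \<longleftrightarrow> (\<exists>z<i. (z, j) \<in> P)"
    if "i \<in> X" "j \<in> X" for i j
    unfolding col'[OF that(2), of "\<lambda>z. z < f i"] using less[OF _ that(1)] sub by auto
  have least: "(\<forall>x\<in>f ` X. f j \<le> x) \<longleftrightarrow> (\<forall>x\<in>X. j \<le> x)" if "j \<in> X" for j
    using le that by auto
  have all: "(\<forall>x y. (x, y) \<in> map_prod f f ` P \<longrightarrow> Q x y) \<longleftrightarrow> (\<forall>i j. (i, j) \<in> P \<longrightarrow> Q (f i) (f j))" for Q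
    by auto
  have 1: "(\<forall>i j. (i, j) \<in> P \<longrightarrow> f i \<in> f ` X \<and> f j \<in> f ` X \<and> f j < f i) \<longleftrightarrow>
      (\<forall>i j. (i, j) \<in> P \<longrightarrow> i \<in> X \<and> j \<in> X \<and> j < i)"
  proof (intro all_cong1 imp_cong refl)
    fix i j assume "(i, j) \<in> P"
    then have X: "i \<in> X" "j \<in> X" using sub by auto
    then show "(f i \<in> f ` X \<and> f j \<in> f ` X \<and> f j < f i) \<longleftrightarrow> (i \<in> X \<and> j \<in> X \<and> j < i)"
      using less by simp
  qed
  have 2: "(\<forall>i j. (i, j) \<in> P \<longrightarrow> ((\<forall>x\<in>f ` X. f j \<le> x) \<or> (\<exists>i'<f i. (i', f j) \<in> map_prod f f ` P) \<or>
        (\<exists>j'. (f j, j') \<in> map_prod f f ` P)) \<noteq> (\<exists>j'<f j. (f i, j') \<in> map_prod f f ` P)) \<longleftrightarrow>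
      (\<forall>i j. (i, j) \<in> P \<longrightarrow> ((\<forall>x\<in>X. j \<le> x) \<or> (\<exists>i'<i. (i', j) \<in> P) \<or> (\<exists>j'. (j, j') \<in> P)) \<noteq>
        (\<exists>j'<j. (i, j') \<in> P))"
  proof (intro all_cong1 imp_cong refl)
    fix i j assume "(i, j) \<in> P"
    then have X: "i \<in> X" "j \<in> X" using sub by auto
    show "((\<forall>x\<in>f ` X. f j \<le> x) \<or> (\<exists>i'<f i. (i', f j) \<in> map_prod f f ` P) \<or>
        (\<exists>j'. (f j, j') \<in> map_prod f f ` P)) \<noteq> (\<exists>j'<f j. (f i, j') \<in> map_prod f f ` P) \<longleftrightarrow>
      ((\<forall>x\<in>X. j \<le> x) \<or> (\<exists>i'<i. (i', j) \<in> P) \<or> (\<exists>j'. (j, j') \<in> P)) \<noteq> (\<exists>j'<j. (i, j') \<in> P)"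
      unfolding least[OF X(2)] above[OF X] row[OF X(2)] left[OF X] ..
  qed
  have 3: "(\<forall>x\<in>f ` X. (\<forall>y\<in>f ` X. x \<le> y) \<or>
        (\<exists>y. (x, y) \<in> map_prod f f ` P) \<or> (\<exists>y. (y, x) \<in> map_prod f f ` P)) \<longleftrightarrow>
      (\<forall>x\<in>X. (\<forall>y\<in>X. x \<le> y) \<or> (\<exists>y. (x, y) \<in> P) \<or> (\<exists>y. (y, x) \<in> P))"
    by (simp only: ball_simps le row col cong: ball_cong)
  show ?thesis
    unfolding htab_def all ex_disj_distrib 1 2 3 ..
qed

text \<open>The point \<open>(M, Min B)\<close> has nothing to its left, so it needs a point above
  it or the least column; this is the last clause of \<open>htab X' P'\<close> at
  \<open>Min B\<close>. Every other point of row \<open>M\<close> has \<open>Min B\<close> to its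
  left and must have nothing above it, which holds because its index is outside \<open>X'\<close>.
  The points of \<open>P'\<close> are unaffected, since row \<open>M\<close> lies below them
  all.\<close>

lemma htab_extend_iff:
  assumes M: "M \<in> X" "\<And>x. x \<in> X \<Longrightarrow> x \<le> M"
    and B: "B \<subseteq> X - {M}" "finite B" "B \<noteq> {}"
    and X': "X' = X - {M} - (B - {Min B})"
    and P': "P' \<subseteq> X' \<times> X'"
  shows "htab X (P' \<union> {M} \<times> B) \<longleftrightarrow> htab X' P'"
proof -
  let ?P = "P' \<union> {M} \<times> B"
  have min: "Min B \<in> B" "\<And>b. b \<in> B \<Longrightarrow> Min B \<le> b" using B by auto
  have minX': "Min B \<in> X'" using min(1) B(1) unfolding X' by blast
  \<comment> \<open>Deleting indices keeps the minimum: \<open>M\<close> is the largest index, and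
    every other deleted index is at least \<open>Min B\<close>, which stays.\<close>
  have least: "(\<forall>x\<in>X. j \<le> x) \<longleftrightarrow> (\<forall>x\<in>X'. j \<le> x)" if "j \<in> X'" for j
  proof
    assume *: "\<forall>x\<in>X'. j \<le> x"
    show "\<forall>x\<in>X. j \<le> x"
    proof
      fix x assume "x \<in> X"
      then consider "x \<in> X'" | "x = M" | "x \<in> B" unfolding X' by auto
      then show "j \<le> x"
      proof cases
        case 2 then show ?thesis using M that X' by auto
      next
        case 3 then show ?thesis using min(2) * minX' order_trans by blast
      qed (use * in auto)
    qed
  qed (auto simp: X')
  have notM: "M \<notin> X'" "M \<notin> B" using X' B by auto
  have row_M: "(M, j) \<in> ?P \<longleftrightarrow> j \<in> B" for j using P' notM by auto
  have row: "(i, j) \<in> ?P \<longleftrightarrow> (i, j) \<in> P'" if "i \<noteq> M" for i j using that by auto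
  have ltM: "x < M" if "x \<in> X'" for x using that M X' by (metis DiffD1 DiffD2 insertI1 le_neq_implies_less)
  have C: "x \<notin> X'" if "x \<in> B" "x \<noteq> Min B" for x using that X' by auto
  show ?thesis
  proof
    assume h: "htab X ?P"
    show "htab X' P'"
    proof (rule htabI)
      fix i j assume ij: "(i, j) \<in> P'"
      then have X: "i \<in> X'" "j \<in> X'" using P' by auto
      then show "i \<in> X' \<and> j \<in> X' \<and> j < i" using htabD(3)[OF h, of i j] ij by auto
      then have ne: "i \<noteq> M" "j \<noteq> M" and lt: "j < i" using notM by auto
      have above: "(\<exists>i'<i. (i', j) \<in> ?P) \<longleftrightarrow> (\<exists>i'<i. (i', j) \<in> P')"
        using ltM[OF X(1)] by auto
      show "((\<forall>x\<in>X'. j \<le> x) \<or> (\<exists>i'<i. (i', j) \<in> P') \<or> (\<exists>j'. (j, j') \<in> P')) \<noteq>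
          (\<exists>j'<j. (i, j') \<in> P')"
        using htabD(4)[OF h, of i j] ij unfolding above row[OF ne(1)] row[OF ne(2)] least[OF X(2)]
        by auto
    next
      fix x assume x: "x \<in> X'"
      then have xX: "x \<in> X" "x \<noteq> M" using X' by auto
      show "(\<forall>y\<in>X'. x \<le> y) \<or> (\<exists>y. (x, y) \<in> P' \<or> (y, x) \<in> P')"
      proof (cases "x \<in> B")
        case True
        then have "x = Min B" using C x by blast
        then have "\<not> (\<exists>j'<x. (M, j') \<in> ?P)" unfolding row_M using min(2) by (meson leD)
        then show ?thesis
          using htabD(4)[OF h, of M x] True xX unfolding row_M least[OF x] by auto
      next
        case False
        then show ?thesis using htabD(5)[OF h xX(1)] xX unfolding least[OF x] by auto
      qed
    qed
  next
    assume h: "htab X' P'"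
    show "htab X ?P"
    proof (rule htabI)
      fix i j assume ij: "(i, j) \<in> ?P"
      show "i \<in> X \<and> j \<in> X \<and> j < i"
      proof (cases "i = M")
        case True
        then have "j \<in> B" using ij row_M by auto
        then show ?thesis using M B True le_neq_implies_less[of j M] by blast
      next
        case False
        then show ?thesis using ij htabD(1-3)[OF h, of i j] X' by auto
      qed
    next
      fix i j assume ij: "(i, j) \<in> ?P"
      show "((\<forall>x\<in>X. j \<le> x) \<or> (\<exists>i'<i. (i', j) \<in> ?P) \<or> (\<exists>j'. (j, j') \<in> ?P)) \<noteq>
          (\<exists>j'<j. (i, j') \<in> ?P)"
      proof (cases "i = M")
        case True
        then have j: "j \<in> B" "j \<noteq> M" using ij row_M notM by auto
        have above: "(\<exists>i'<M. (i', j) \<in> ?P) \<longleftrightarrow> (\<exists>i'. (i', j) \<in> P')"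
          using P' ltM by auto
        show ?thesis
        proof (cases "j = Min B")
          case True
          have "\<not> (\<exists>j'<j. (M, j') \<in> ?P)" unfolding row_M using min(2) True by (meson leD)
          moreover have "(\<forall>x\<in>X. j \<le> x) \<or> (\<exists>i'<M. (i', j) \<in> ?P) \<or> (\<exists>j'. (j, j') \<in> ?P)"
            using htabD(5)[OF h minX'] least[OF minX'] unfolding above True[symmetric] by auto
          ultimately show ?thesis unfolding \<open>i = M\<close> by blast
        next
          case False
          then have "Min B < j" using min(2)[OF j(1)] by simp
          then have "\<exists>j'<j. (M, j') \<in> ?P" unfolding row_M using min(1) by blast
          moreover have "\<not> (\<forall>x\<in>X. j \<le> x)" using \<open>Min B < j\<close> min(1) B by (meson DiffD1 leD subsetD)
          moreover have "\<not> (\<exists>i'<M. (i', j) \<in> ?P)" "\<not> (\<exists>j'. (j, j') \<in> ?P)"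
            unfolding above row[OF j(2)] using C[OF j(1) False] P' by auto
          ultimately show ?thesis unfolding \<open>i = M\<close> by blast
        qed
      next
        case False
        then have ij': "(i, j) \<in> P'" using ij by auto
        then have X: "i \<in> X'" "j \<in> X'" using P' by auto
        then have ne: "i \<noteq> M" "j \<noteq> M" using notM by auto
        have above: "(\<exists>i'<i. (i', j) \<in> ?P) \<longleftrightarrow> (\<exists>i'<i. (i', j) \<in> P')"
          using ltM[OF X(1)] by auto
        show ?thesis
          using htabD(4)[OF h ij'] unfolding above row[OF ne(1)] row[OF ne(2)] least[OF X(2)] .
      qed
    next
      fix x assume "x \<in> X"
      then consider "x \<in> X'" | "x = M" | "x \<in> B" unfolding X' by auto
      then show "(\<forall>y\<in>X. x \<le> y) \<or> (\<exists>y. (x, y) \<in> ?P \<or> (y, x) \<in> ?P)"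
      proof cases
        case 1 then show ?thesis using htabD(5)[OF h 1] least[OF 1] by auto
      qed (use B in auto)
    qed
  qed
qed

text \<open>A point of row \<open>M\<close> in a column \<open>c\<close> other than
  \<open>Min B\<close> has \<open>Min B\<close> to its left, hence nothing above it: column
  \<open>c\<close> has no further point, and row \<open>c\<close>, the reflected part of that
  column, has none at all. So all points outside row \<open>M\<close> avoid the deleted
  indices.\<close>

lemma htab_decompose:
  assumes h: "htab X P" and M: "M \<in> X" "\<And>x. x \<in> X \<Longrightarrow> x \<le> M"
    and B: "B = {j. (M, j) \<in> P}" "finite B"
    and X': "X' = X - {M} - (B - {Min B})"
  shows "P = P \<inter> (X' \<times> X') \<union> {M} \<times> B"
proof -
  have "(i, j) \<in> X' \<times> X'" if ij: "(i, j) \<in> P" "i \<noteq> M" for i j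
  proof -
    have lt: "i \<in> X" "j \<in> X" "j < i" "i < M"
      using htabD(1-3)[OF h ij(1)] M(2)[of i] ij(2) by auto
    have C: "\<not> (\<forall>x\<in>X. c \<le> x) \<and> \<not> (\<exists>i'<M. (i', c) \<in> P) \<and> \<not> (\<exists>j'. (c, j') \<in> P)"
      if "c \<in> B" "c \<noteq> Min B" for c
    proof -
      have "Min B \<in> B" using that(1) B(2) by (intro Min_in) auto
      moreover from this have "Min B < c" using that B(2) by (simp add: order_less_le)
      ultimately have "Min B \<in> B" "Min B < c" .
      then show ?thesis using htabD(4)[OF h, of M c] that B(1) by auto
    qed
    show ?thesis
      using C[of i] C[of j] lt ij unfolding X' by auto
  qed
  then show ?thesis unfolding B by auto
qed


section \<open>Half tableaux with \<open>n\<close> rows\<close>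

abbreviation shift_rows :: "cell set \<Rightarrow> cell set" where
  "shift_rows H \<equiv> map_prod Suc id ` H"

lemma inj_shift_rows: "shift_rows H = shift_rows H' \<longleftrightarrow> H = H'"
  by (rule inj_image_eq_iff) (auto simp: inj_on_def)

lemma shift_rows_mem [simp]: "(Suc r, c) \<in> shift_rows H \<longleftrightarrow> (r, c) \<in> H"
  by force

lemma fst_shift_rows: "fst ` shift_rows H = Suc ` fst ` H"
  by force

definition half_tableaux :: "nat \<Rightarrow> cell set set" where
  "half_tableaux n = {H. htab {1..n + 1} (shift_rows H)}"

lemma half_tableaux_memD:
  assumes "H \<in> half_tableaux n" "(r, c) \<in> H"
  shows "1 \<le> c" "c \<le> r" "r \<le> n"
  using htabD(1-3)[of "{1..n + 1}" "shift_rows H" "Suc r" c] assms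
  by (auto simp: half_tableaux_def)

lemma half_tableaux_subset: "H \<in> half_tableaux n \<Longrightarrow> H \<subseteq> {1..n} \<times> {1..n}"
  using half_tableaux_memD by fastforce

lemma htab_imp_shift_rows:
  assumes "htab X P"
  obtains H where "P = shift_rows H"
proof
  have "p \<in> shift_rows {(r, c). (Suc r, c) \<in> P}" if "p \<in> P" for p
  proof -
    obtain i j where p: "p = (i, j)" by force
    then have "j < i" using htabD(3)[OF assms, of i j] that by simp
    then obtain r where "i = Suc r" by (cases i) auto
    then show ?thesis using p that by simp
  qed
  then show "P = shift_rows {(r, c). (Suc r, c) \<in> P}" by auto
qed

lemma last_row_shift_rows:
  assumes "H \<in> half_tableaux n"
  shows "last_row n H = {j. (n + 1, j) \<in> shift_rows H}"
  using half_tableaux_memD[OF assms] by (auto simp: last_row_def)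

text \<open>Index \<open>n + 1\<close> is not the least one, so the last clause of
  \<open>htab\<close> gives it a point; that point lies in row \<open>n + 1\<close>, since its
  column is smaller than its row. On half tableaux the default value in \<open>half_Xi\<close> is
  thus taken only at \<open>n = 0\<close>.\<close>

lemma last_row_nonempty:
  assumes H: "H \<in> half_tableaux n" and "n > 0"
  shows "last_row n H \<noteq> {}"
proof -
  have h: "htab {1..n + 1} (shift_rows H)" using H by (simp add: half_tableaux_def)
  have "\<exists>y. (n + 1, y) \<in> shift_rows H \<or> (y, n + 1) \<in> shift_rows H"
    using htabD(5)[OF h, of "n + 1"] \<open>n > 0\<close> by force
  moreover have "(y, n + 1) \<notin> shift_rows H" for y
    using htabD(1)[OF h, of y "n + 1"] htabD(3)[OF h, of y "n + 1"] by fastforce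
  ultimately show ?thesis unfolding last_row_shift_rows[OF H] by auto
qed

section \<open>Contraction along a prescribed last row\<close>

text \<open>The deleted indices \<open>C\<close> and the new number \<open>rank c\<close> of column
  \<open>c\<close> are those of \<open>contract n B\<close>; \<open>X\<close> collects the surviving
  indices. Index \<open>n + 1\<close>, the last row after the shift, is already outside
  \<open>X\<close>.\<close>

locale insertion =
  fixes n :: nat and B C X :: "nat set" and rank :: "nat \<Rightarrow> nat"
  assumes B: "B \<subseteq> {1..n}" "B \<noteq> {}"
  defines "C \<equiv> B - {Min B}"
    and "X \<equiv> {1..n} - C"
    and "rank c \<equiv> card ({1..c} - C)"
begin

lemma finite_B: "finite B"
  using B finite_subset by blast

lemma X_eq: "X = {1..n + 1} - {n + 1} - (B - {Min B})"
  unfolding X_def C_def by auto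

text \<open>Index 1 is therefore never deleted, and the truncated subtraction \<open>i - 1\<close>
  is injective on \<open>C\<close>.\<close>

lemma C_ge_2: "c \<in> C \<Longrightarrow> 2 \<le> c"
proof -
  assume "c \<in> C"
  then have "Min B < c" "1 \<le> Min B"
    using B finite_B Min_in[OF finite_B B(2)] by (auto simp: C_def order_less_le)
  then show ?thesis by simp
qed

text \<open>\<open>Min B\<close> survives, so only \<open>card B - 1\<close> of the \<open>n\<close>
  indices are lost. The result is the number of indices of a half tableau with
  \<open>n - card B\<close> rows.\<close>

lemma card_X: "card X = n - card B + 1"
proof -
  have "card B \<le> n" using card_mono[OF _ B(1)] by simp
  moreover have "card B > 0" using B finite_B by (simp add: card_gt_0_iff)
  moreover have "card C = card B - 1"
    unfolding C_def using Min_in[OF finite_B B(2)] finite_B by simp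
  moreover have "card X = n - card C"
    unfolding X_def C_def using B finite_B by (subst card_Diff_subset) auto
  ultimately show ?thesis by simp
qed

lemma strict_mono_rank: "strict_mono_on X rank"
proof (rule strict_mono_onI)
  fix x y assume "x \<in> X" "y \<in> X" "x < y"
  then have "y \<in> {1..y} - C" "y \<notin> {1..x} - C" "{1..x} - C \<subseteq> {1..y} - C"
    unfolding X_def by auto
  then have "{1..x} - C \<subset> {1..y} - C" by blast
  then show "rank x < rank y" unfolding rank_def by (intro psubset_card_mono) auto
qed

text \<open>By injectivity of \<open>rank\<close> it is enough that its values lie in an interval
  with as many elements as \<open>X\<close>.\<close>

lemma rank_image: "rank ` X = {1..n - card B + 1}"
proof (rule card_subset_eq)
  show "rank ` X \<subseteq> {1..n - card B + 1}"
  proof (rule image_subsetI)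
    fix x assume x: "x \<in> X"
    then have "{1..x} - C \<noteq> {}" by (auto simp: X_def)
    moreover have "{1..x} - C \<subseteq> X" using x by (auto simp: X_def)
    then have "card ({1..x} - C) \<le> card X" by (intro card_mono) (auto simp: X_def)
    ultimately show "rank x \<in> {1..n - card B + 1}"
      unfolding card_X by (simp add: rank_def Suc_le_eq card_gt_0_iff)
  qed
  show "card (rank ` X) = card {1..n - card B + 1}"
    using card_image[OF strict_mono_on_imp_inj_on[OF strict_mono_rank]] by (simp add: card_X)
qed simp

text \<open>\<open>contract\<close> renumbers rows and columns by two different counts. After the
  shift of rows both are the same map \<open>rank\<close>; the outer \<open>Suc\<close> accounts for
  index 1, which has no row in the half tableau.\<close>

lemma rank_Suc: "rank (Suc r) = Suc (card ({1..r} - (\<lambda>i. i - 1) ` C))"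
proof -
  have "{1..Suc r} - C = insert 1 (Suc ` ({1..r} - (\<lambda>i. i - 1) ` C))" (is "?L = ?R")
  proof (intro set_eqI iffI)
    fix x assume "x \<in> ?L"
    then have x: "1 \<le> x" "x \<le> Suc r" "x \<notin> C" by auto
    show "x \<in> ?R"
    proof (cases "x = 1")
      case False
      then have "x = Suc (x - 1)" using x by simp
      moreover have "x - 1 \<notin> (\<lambda>i. i - 1) ` C"
      proof
        assume "x - 1 \<in> (\<lambda>i. i - 1) ` C"
        then obtain i where "i \<in> C" "x - 1 = i - 1" by auto
        then have "x = i" using C_ge_2[of i] x by simp
        then show False using x \<open>i \<in> C\<close> by simp
      qed
      moreover have "x - 1 \<in> {1..r}" using x False by auto
      ultimately show ?thesis by blast
    qed simp
  next
    fix x assume "x \<in> ?R"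
    then show "x \<in> ?L" using C_ge_2[of 1] by force
  qed
  then show ?thesis
    unfolding rank_def by (simp add: card_image image_iff card_insert_if)
qed

text \<open>This replaces the explicit formula of \<open>contract\<close> by a restriction to
  \<open>X\<close> followed by an order isomorphism, the form to which
  \<open>htab_extend_iff\<close> and \<open>htab_image\<close> apply.\<close>

lemma shift_rows_contract:
  assumes H: "H \<in> half_tableaux n"
  shows "shift_rows (contract n B H) = map_prod rank rank ` (shift_rows H \<inter> X \<times> X)"
proof -
  \<comment> \<open>Row \<open>r\<close> has index \<open>Suc r\<close>, so \<open>r < n\<close>
    excludes exactly the last row, and \<open>r\<close> is a deleted row iff \<open>Suc r\<close> is
    in \<open>C\<close>.\<close>
  have iff: "r < n \<and> r \<notin> (\<lambda>i. i - 1) ` C \<and> c \<notin> C \<longleftrightarrow> Suc r \<in> X \<and> c \<in> X"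
    if "(r, c) \<in> H" for r c
  proof -
    have "1 \<le> c" "c \<le> r" "r \<le> n" using half_tableaux_memD[OF H that] by auto
    moreover have "r \<in> (\<lambda>i. i - 1) ` C \<longleftrightarrow> Suc r \<in> C"
      using C_ge_2 by (force simp: image_iff)
    ultimately show ?thesis by (auto simp: X_def)
  qed
  have "contract n B H = (\<lambda>(r, c). (card ({1..r} - (\<lambda>i. i - 1) ` C), rank c)) `
      {(r, c) \<in> H. Suc r \<in> X \<and> c \<in> X}"
    unfolding contract_def Let_def C_def[symmetric] rank_def using iff by (force simp: image_iff)
  moreover have "shift_rows H \<inter> X \<times> X = map_prod Suc id ` {(r, c) \<in> H. Suc r \<in> X \<and> c \<in> X}"
    by auto
  ultimately show ?thesis
    by (simp add: image_image rank_Suc case_prod_unfold map_prod_def)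
qed

lemma half_tableaux_decompose:
  assumes H: "H \<in> half_tableaux n" "last_row n H = B"
  shows "shift_rows H = shift_rows H \<inter> X \<times> X \<union> {n + 1} \<times> B"
  using H htab_decompose[of "{1..n + 1}" "shift_rows H" "n + 1" B X] last_row_shift_rows[OF H(1)]
    finite_B X_eq by (auto simp: half_tableaux_def)

lemma htab_extend_rank_iff:
  assumes "P \<subseteq> X \<times> X"
  shows "htab {1..n + 1} (P \<union> {n + 1} \<times> B) \<longleftrightarrow>
    htab {1..n - card B + 1} (map_prod rank rank ` P)"
proof -
  have "htab {1..n + 1} (P \<union> {n + 1} \<times> B) \<longleftrightarrow> htab X P"
    by (rule htab_extend_iff) (use B finite_B X_eq assms in auto)
  also have "\<dots> \<longleftrightarrow> htab (rank ` X) (map_prod rank rank ` P)"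
    using htab_image[OF strict_mono_rank assms] by simp
  finally show ?thesis unfolding rank_image .
qed

text \<open>Injective: the contraction determines the points on \<open>X\<close> because
  \<open>rank\<close> is injective, and \<open>B\<close> supplies all the others. Surjective: pull
  the given points back along \<open>rank\<close> and append \<open>B\<close> as row
  \<open>n + 1\<close>.\<close>

lemma bij_betw_contract:
  "bij_betw (contract n B) {H \<in> half_tableaux n. last_row n H = B} (half_tableaux (n - card B))"
  unfolding bij_betw_def
proof (rule conjI, rule inj_onI)
  have inj: "inj_on (map_prod rank rank) (X \<times> X)"
    using strict_mono_on_imp_inj_on[OF strict_mono_rank] by (simp add: map_prod_inj_on)
  fix H1 H2
  assume H: "H1 \<in> {H \<in> half_tableaux n. last_row n H = B}"
    "H2 \<in> {H \<in> half_tableaux n. last_row n H = B}"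
    and eq: "contract n B H1 = contract n B H2"
  have "map_prod rank rank ` (shift_rows H1 \<inter> X \<times> X) =
      map_prod rank rank ` (shift_rows H2 \<inter> X \<times> X)"
    using H eq shift_rows_contract by (metis (mono_tags, lifting) mem_Collect_eq)
  then have "shift_rows H1 \<inter> X \<times> X = shift_rows H2 \<inter> X \<times> X"
    using inj_on_image_eq_iff[OF inj] by (metis inf_le2)
  then have "shift_rows H1 = shift_rows H2"
    using half_tableaux_decompose H by (metis (mono_tags, lifting) mem_Collect_eq)
  then show "H1 = H2" by (simp only: inj_shift_rows)
next
  show "contract n B ` {H \<in> half_tableaux n. last_row n H = B} = half_tableaux (n - card B)"
  proof (intro set_eqI iffI)
    fix H' assume "H' \<in> contract n B ` {H \<in> half_tableaux n. last_row n H = B}"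
    then obtain H where H: "H \<in> half_tableaux n" "last_row n H = B" "H' = contract n B H" by auto
    have "htab {1..n + 1} (shift_rows H \<inter> X \<times> X \<union> {n + 1} \<times> B)"
      using H(1) half_tableaux_decompose[OF H(1,2)] by (simp add: half_tableaux_def)
    then show "H' \<in> half_tableaux (n - card B)"
      using htab_extend_rank_iff[of "shift_rows H \<inter> X \<times> X"] shift_rows_contract[OF H(1)]
      by (simp add: half_tableaux_def H(3))
  next
    fix H' assume "H' \<in> half_tableaux (n - card B)"
    then have h: "htab {1..n - card B + 1} (shift_rows H')" by (simp add: half_tableaux_def)
    have "p \<in> rank ` X \<times> rank ` X" if "p \<in> shift_rows H'" for p
      using that htabD(1,2)[OF h, of "fst p" "snd p"] unfolding rank_image mem_Times_iff by simp
    then have "shift_rows H' \<subseteq> map_prod rank rank ` (X \<times> X)"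
      unfolding map_prod_surj_on[OF refl refl] by blast
    then obtain P where P: "P \<subseteq> X \<times> X" "shift_rows H' = map_prod rank rank ` P"
      by (auto simp: subset_image_iff)
    then have hP: "htab {1..n + 1} (P \<union> {n + 1} \<times> B)" using htab_extend_rank_iff h by simp
    then obtain H where H: "P \<union> {n + 1} \<times> B = shift_rows H" by (rule htab_imp_shift_rows)
    then have mem: "H \<in> half_tableaux n" using hP by (simp add: half_tableaux_def)
    \<comment> \<open>The appended row is disjoint from \<open>P\<close>, so reading off the last
      row returns \<open>B\<close> and restricting to \<open>X\<close> returns
      \<open>P\<close>.\<close>
    have "n + 1 \<notin> X" by (simp add: X_def)
    then have "last_row n H = B"
      unfolding last_row_shift_rows[OF mem] H[symmetric] using P(1) by auto
    moreover have "shift_rows H \<inter> X \<times> X = P"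
      unfolding H[symmetric] using P(1) \<open>n + 1 \<notin> X\<close> by auto
    then have "shift_rows (contract n B H) = shift_rows H'"
      unfolding shift_rows_contract[OF mem] P(2) by simp
    then have "contract n B H = H'" by (simp only: inj_shift_rows)
    ultimately show "H' \<in> contract n B ` {H \<in> half_tableaux n. last_row n H = B}"
      using mem by auto
  qed
qed

lemma card_rows_contract:
  assumes H: "H \<in> half_tableaux n" "last_row n H = B"
  shows "card (fst ` H) = Suc (card (fst ` contract n B H))"
proof -
  have card_shift: "card (fst ` shift_rows G) = card (fst ` G)" for G
    unfolding fst_shift_rows by (simp add: card_image)
  let ?P = "shift_rows H \<inter> X \<times> X"
  have sub: "fst ` ?P \<subseteq> X" by auto
  have "fst ` shift_rows H = insert (n + 1) (fst ` ?P)"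
    using B(2) by (subst half_tableaux_decompose[OF H]) (simp add: image_Un)
  moreover have "n + 1 \<notin> fst ` ?P" by (auto simp: X_def)
  moreover have "finite (fst ` ?P)" by (rule finite_subset[OF sub]) (simp add: X_def)
  ultimately have "card (fst ` shift_rows H) = Suc (card (fst ` ?P))" by simp
  also have "fst ` map_prod rank rank ` ?P = rank ` fst ` ?P" by force
  then have "card (fst ` ?P) = card (fst ` shift_rows (contract n B H))"
    unfolding shift_rows_contract[OF H(1)]
    using card_image[OF inj_on_subset[OF strict_mono_on_imp_inj_on[OF strict_mono_rank] sub]]
    by simp
  finally show ?thesis by (simp only: card_shift)
qed

end

section \<open>Ordered partitions and relabelling\<close>

text \<open>The ground set is arbitrary because splitting off a block \<open>B\<close> leaves
  \<open>X - B\<close>, which need not be an initial segment.\<close>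

definition block_lists :: "nat set \<Rightarrow> nat set list set" where
  "block_lists X = {bs. distinct bs \<and> partition_on X (set bs)}"

text \<open>The counterpart, for ordered partitions, of splitting off the last row.\<close>

lemma block_lists_snoc:
  "bs @ [B] \<in> block_lists X \<longleftrightarrow> B \<noteq> {} \<and> B \<subseteq> X \<and> bs \<in> block_lists (X - B)"
proof (cases "disjnt B (\<Union>(set bs))")
  case True
  \<comment> \<open>Distinctness comes for free: a nonempty set disjoint from all blocks is none of
    them.\<close>
  then have "B \<notin> set bs" if "B \<noteq> {}" using that by (auto simp: disjnt_def)
  then show ?thesis
    using partition_on_insert[OF True, of X] by (auto simp: block_lists_def)
next
  \<comment> \<open>If \<open>B\<close> meets an earlier block, both sides fail: that block does not
    fit into \<open>X - B\<close>, and next to \<open>B\<close> it is either a repetition or an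
    overlap.\<close>
  case False
  then have "\<not> partition_on (X - B) (set bs)" by (auto simp: partition_on_def disjnt_def)
  moreover have "\<not> (B \<notin> set bs \<and> partition_on X (insert B (set bs)))"
    using False by (auto simp: partition_on_def disjoint_def disjnt_def)
  ultimately show ?thesis by (auto simp: block_lists_def)
qed

lemma map_image_block_lists:
  assumes f: "inj_on f X" and bs: "bs \<in> block_lists X"
  shows "map ((`) f) bs \<in> block_lists (f ` X)"
proof -
  have part: "partition_on X (set bs)" "distinct bs" using bs by (auto simp: block_lists_def)
  have "inj_on ((`) f) (set bs)"
    using inj_on_image_Pow[OF f] by (rule inj_on_subset) (use partition_onD1[OF part(1)] in auto)
  moreover have "{} \<notin> (`) f ` set bs" using partition_onD3[OF part(1)] by auto
  ultimately show ?thesis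
    using partition_on_inj_image[OF part(1) f] part(2) by (simp add: block_lists_def distinct_map)
qed

lemma bij_betw_block_lists:
  assumes f: "bij_betw f X Y"
  shows "bij_betw (map ((`) f)) (block_lists X) (block_lists Y)"
proof -
  let ?g = "the_inv_into X f"
  have g: "bij_betw ?g Y X" by (rule bij_betw_the_inv_into[OF f])
  have sub: "b \<subseteq> Z" if "bs \<in> block_lists Z" "b \<in> set bs" for Z b bs
    using that partition_onD1[of Z "set bs"] by (auto simp: block_lists_def)
  show ?thesis
  proof (rule bij_betw_byWitness[where f' = "map ((`) ?g)"])
    show "\<forall>bs\<in>block_lists X. map ((`) ?g) (map ((`) f) bs) = bs"
    proof
      fix bs assume bs: "bs \<in> block_lists X"
      have "?g ` f ` b = b" if "b \<in> set bs" for b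
        using sub[OF bs that] the_inv_into_f_f[OF bij_betw_imp_inj_on[OF f]]
        by (force simp: image_image image_iff)
      then show "map ((`) ?g) (map ((`) f) bs) = bs" by (simp add: map_idI)
    qed
    show "\<forall>bs\<in>block_lists Y. map ((`) f) (map ((`) ?g) bs) = bs"
    proof
      fix bs assume bs: "bs \<in> block_lists Y"
      have "f ` ?g ` b = b" if "b \<in> set bs" for b
        using sub[OF bs that] f_the_inv_into_f_bij_betw[OF f]
        by (force simp: image_image image_iff)
      then show "map ((`) f) (map ((`) ?g) bs) = bs" by (simp add: map_idI)
    qed
    show "map ((`) f) ` block_lists X \<subseteq> block_lists Y"
      using map_image_block_lists[OF bij_betw_imp_inj_on[OF f]] bij_betw_imp_surj_on[OF f] by auto
    show "map ((`) ?g) ` block_lists Y \<subseteq> block_lists X"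
      using map_image_block_lists[OF bij_betw_imp_inj_on[OF g]] bij_betw_imp_surj_on[OF g] by auto
  qed
qed

text \<open>Labels start at 1 and list positions at 0, whence the detour through
  \<open>k - 1\<close>; indexing is then bijective because the sorted list has distinct
  entries.\<close>

lemma bij_betw_relabel:
  assumes B: "B \<subseteq> {1..n}"
  shows "bij_betw (relabel n B) {1..n - card B} ({1..n} - B)"
proof -
  let ?xs = "sorted_list_of_set ({1..n} - B)"
  have len: "length ?xs = n - card B"
    using B finite_subset[OF B] by (simp add: card_Diff_subset)
  have "bij_betw (\<lambda>k. k - 1) {1..n - card B} {..<n - card B}"
    by (rule bij_betw_byWitness[where f' = Suc]) auto
  moreover have "bij_betw ((!) ?xs) {..<n - card B} ({1..n} - B)"
    by (rule bij_betw_nth) (use len in auto)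
  ultimately have "bij_betw ((!) ?xs \<circ> (\<lambda>k. k - 1)) {1..n - card B} ({1..n} - B)"
    by (rule bij_betw_trans)
  then show ?thesis by (simp add: relabel_def[abs_def] comp_def)
qed

section \<open>The recursion as a bijection\<close>

lemma half_Xi_0 [simp]: "half_Xi 0 H = []"
  by (simp add: half_Xi.simps)

lemma half_Xi_step:
  assumes "H \<in> half_tableaux n" "n > 0" "last_row n H = B"
  shows "half_Xi n H = map ((`) (relabel n B)) (half_Xi (n - card B) (contract n B H)) @ [B]"
  using last_row_nonempty[OF assms(1,2)] assms by (subst half_Xi.simps) (simp add: Let_def)

lemma half_tableaux_0: "half_tableaux 0 = {{}}"
proof -
  have "{} \<in> half_tableaux 0" by (simp add: half_tableaux_def htab_def)
  then show ?thesis using half_tableaux_subset[of _ 0] by auto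
qed

lemma block_lists_empty: "block_lists {} = {[]}"
  by (auto simp: block_lists_def partition_on_empty)

text \<open>Half tableaux are classified by their last row, ordered partitions by their last block.
  For each fixed \<open>B\<close>, contraction, the induction hypothesis and relabelling compose to
  a bijection. The length is carried along because each step adds one block and removes one nonempty
  row.\<close>

lemma half_Xi_correct:
  "bij_betw (half_Xi n) (half_tableaux n) (block_lists {1..n}) \<and>
   (\<forall>H\<in>half_tableaux n. length (half_Xi n H) = card (fst ` H))"
proof (induction n rule: less_induct)
  case (less n)
  show ?case
  proof (cases "n = 0")
    case True
    then show ?thesis by (simp add: half_tableaux_0 block_lists_empty bij_betw_def)
  next
    case False
    then have n: "n > 0" by simp
    let ?row = "\<lambda>B. {H \<in> half_tableaux n. last_row n H = B}"
    have row: "last_row n H \<subseteq> {1..n}" for H by (auto simp: last_row_def)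
    have ins: "insertion n B" if "H \<in> ?row B" for H B
      using that last_row_nonempty[OF _ n] row by unfold_locales auto
    have smaller: "n - card B < n" if "B \<subseteq> {1..n}" "B \<noteq> {}" for B
      using that n finite_subset[OF that(1)] by (simp add: card_gt_0_iff)
    have bij: "bij_betw (\<lambda>H. map ((`) (relabel n B)) (half_Xi (n - card B) (contract n B H)))
        (?row B) (block_lists ({1..n} - B))" if "B \<subseteq> {1..n}" "B \<noteq> {}" for B
    proof -
      interpret insertion n B "B - {Min B}" "{1..n} - (B - {Min B})"
        "\<lambda>c. card ({1..c} - (B - {Min B}))"
        by unfold_locales (use that in auto)
      show ?thesis
        using bij_betw_trans[OF bij_betw_trans[OF bij_betw_contract
              conjunct1[OF less.IH[OF smaller[OF that]]]]
            bij_betw_block_lists[OF bij_betw_relabel[OF that(1)]]]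
        by (simp add: comp_def)
    qed
    have "inj_on (half_Xi n) (half_tableaux n)"
    proof (rule inj_onI)
      fix H1 H2
      assume H: "H1 \<in> half_tableaux n" "H2 \<in> half_tableaux n" and eq: "half_Xi n H1 = half_Xi n H2"
      \<comment> \<open>The last block of an image is the last row of its half tableau, so equal
        images come from the same class.\<close>
      have B: "last_row n H2 = last_row n H1"
        using eq half_Xi_step[OF H(1) n refl] half_Xi_step[OF H(2) n refl] by simp
      have "inj_on (\<lambda>H. map ((`) (relabel n (last_row n H1)))
          (half_Xi (n - card (last_row n H1)) (contract n (last_row n H1) H))) (?row (last_row n H1))"
        using bij[OF row last_row_nonempty[OF H(1) n]] by (rule bij_betw_imp_inj_on)
      then show "H1 = H2"
        by (rule inj_onD) (use H B eq half_Xi_step[OF H(1) n refl] half_Xi_step[OF H(2) n B] in auto)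
    qed
    moreover have "half_Xi n ` half_tableaux n = block_lists {1..n}"
    proof (intro set_eqI iffI)
      fix bs assume "bs \<in> half_Xi n ` half_tableaux n"
      then obtain H where H: "H \<in> half_tableaux n" "bs = half_Xi n H" by auto
      show "bs \<in> block_lists {1..n}"
        unfolding H(2) half_Xi_step[OF H(1) n refl] block_lists_snoc
        using bij_betw_apply[OF bij[OF row last_row_nonempty[OF H(1) n]]] H(1)
          last_row_nonempty[OF H(1) n] row by blast
    next
      fix bs assume bs: "bs \<in> block_lists {1..n}"
      then have "bs \<noteq> []" using n by (auto simp: block_lists_def partition_on_def)
      then obtain cs B where cs: "bs = cs @ [B]" by (metis rev_exhaust)
      then have B: "B \<subseteq> {1..n}" "B \<noteq> {}" "cs \<in> block_lists ({1..n} - B)"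
        using bs by (auto simp: block_lists_snoc)
      then obtain H where H: "H \<in> half_tableaux n" "last_row n H = B"
        "cs = map ((`) (relabel n B)) (half_Xi (n - card B) (contract n B H))"
        using bij_betw_imp_surj_on[OF bij[OF B(1,2)]] by auto
      then have "bs = half_Xi n H" using half_Xi_step[OF H(1) n H(2)] cs by simp
      then show "bs \<in> half_Xi n ` half_tableaux n" using H(1) by simp
    qed
    moreover have "length (half_Xi n H) = card (fst ` H)" if H: "H \<in> half_tableaux n" for H
    proof -
      define B where "B = last_row n H"
      have B: "B \<subseteq> {1..n}" "B \<noteq> {}" using row last_row_nonempty[OF H n] by (auto simp: B_def)
      interpret insertion n B "B - {Min B}" "{1..n} - (B - {Min B})"
        "\<lambda>c. card ({1..c} - (B - {Min B}))"
        by unfold_locales (use B in auto)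
      have "contract n B H \<in> half_tableaux (n - card B)"
        using bij_betw_apply[OF bij_betw_contract] H B_def by blast
      then show ?thesis
        using less.IH[OF smaller[OF B]] half_Xi_step[OF H n B_def[symmetric]]
          card_rows_contract[OF H B_def[symmetric]] by simp
    qed
    ultimately show ?thesis by (simp add: bij_betw_def)
  qed
qed

section \<open>Square symmetric tableaux and their lower halves\<close>

lemma swap_image_eq_iff: "prod.swap ` S = S \<longleftrightarrow> (\<forall>i j. (i, j) \<in> S \<longrightarrow> (j, i) \<in> S)"
proof
  show "prod.swap ` S = S \<Longrightarrow> \<forall>i j. (i, j) \<in> S \<longrightarrow> (j, i) \<in> S" by force
  show "prod.swap ` S = S" if "\<forall>i j. (i, j) \<in> S \<longrightarrow> (j, i) \<in> S"
    using that by (force simp: image_iff)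
qed

lemma ferrers_diagram_square: "ferrers_diagram ({1..k} \<times> {1..k})"
  unfolding ferrers_diagram_def
  by (intro conjI exI[of _ "\<lambda>i. if i \<le> k then k else 0"]) (auto split: if_splits)

text \<open>\<open>?L\<close> holds the leftmost point of each row and \<open>?A\<close> the topmost
  point of each column, so both have \<open>k\<close> elements. By the exclusive or, a point other
  than the root lies in exactly one of them, while the root lies in both.\<close>

lemma card_points_square:
  assumes T: "tree_like_tableau T" and cells: "cells T = {1..k} \<times> {1..k}"
  shows "card (points T) + 1 = 2 * k"
proof -
  let ?Q = "points T"
  let ?L = "{p \<in> ?Q. \<not> point_left T p}" and ?A = "{p \<in> ?Q. \<not> point_above T p}"
  have Q: "?Q \<subseteq> {1..k} \<times> {1..k}" "(1, 1) \<in> ?Q"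
    using T cells by (auto simp: tree_like_tableau_def)
  have pointed: "\<exists>j. (i, j) \<in> ?Q" "\<exists>j. (j, i) \<in> ?Q" if "i \<in> {1..k}" for i
    using T that unfolding tree_like_tableau_def cells by blast+
  have "finite ?Q" using Q(1) finite_subset by blast
  have "bij_betw fst ?L {1..k}"
    unfolding bij_betw_def
  proof (rule conjI)
    show "inj_on fst ?L"
      by (auto simp: inj_on_def point_left_def) (meson linorder_neqE_nat)
    show "fst ` ?L = {1..k}"
    proof (intro equalityI subsetI)
      fix i assume "i \<in> {1..k}"
      then obtain j where "(i, j) \<in> ?Q" using pointed by blast
      then have "(i, LEAST j. (i, j) \<in> ?Q) \<in> ?L"
        by (auto simp: point_left_def intro: LeastI dest: not_less_Least)
      then show "i \<in> fst ` ?L" by force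
    qed (use Q in auto)
  qed
  then have L: "card ?L = k" using bij_betw_same_card by fastforce
  have "bij_betw snd ?A {1..k}"
    unfolding bij_betw_def
  proof (rule conjI)
    show "inj_on snd ?A"
      by (auto simp: inj_on_def point_above_def) (meson linorder_neqE_nat)
    show "snd ` ?A = {1..k}"
    proof (intro equalityI subsetI)
      fix j assume "j \<in> {1..k}"
      then obtain i where "(i, j) \<in> ?Q" using pointed by blast
      then have "(LEAST i. (i, j) \<in> ?Q, j) \<in> ?A"
        by (auto simp: point_above_def intro: LeastI dest: not_less_Least)
      then show "j \<in> snd ` ?A" by force
    qed (use Q in auto)
  qed
  then have A: "card ?A = k" using bij_betw_same_card by fastforce
  have xor: "point_above T c \<noteq> point_left T c" if "c \<in> ?Q" "c \<noteq> (1, 1)" for c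
    using T that unfolding tree_like_tableau_def by blast
  have root: "\<not> point_left T (1, 1)" "\<not> point_above T (1, 1)"
    using Q(1) by (auto simp: point_left_def point_above_def)
  have "?L \<union> ?A = ?Q" using xor root by blast
  moreover have "?L \<inter> ?A = {(1, 1)}" using xor root Q(2) by blast
  moreover have "card ?L + card ?A = card (?L \<union> ?A) + card (?L \<inter> ?A)"
    by (rule card_Un_Int) (use \<open>finite ?Q\<close> in auto)
  ultimately show ?thesis using L A by simp
qed

text \<open>Column \<open>j\<close> splits at the diagonal: its lower part is in \<open>P\<close>,
  its diagonal cell is pointed only at the root, and its upper part is the reflection of row
  \<open>j\<close> of \<open>P\<close>.\<close>

lemma tree_like_iff_htab:
  assumes cells: "cells T = {1..k} \<times> {1..k}" and sub: "points T \<subseteq> cells T"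
    and root: "(1, 1) \<in> points T"
    and sym: "\<And>i j. (i, j) \<in> points T \<Longrightarrow> (j, i) \<in> points T"
    and diag: "\<And>i. (i, i) \<in> points T \<Longrightarrow> i = 1"
    and P: "P = {(i, j) \<in> points T. j < i}"
  shows "tree_like_tableau T \<longleftrightarrow> htab {1..k} P"
proof -
  let ?Q = "points T"
  have Q: "1 \<le> i \<and> i \<le> k \<and> 1 \<le> j \<and> j \<le> k" if "(i, j) \<in> ?Q" for i j
    using that sub cells by auto
  have k: "1 \<le> k" using Q[OF root] by simp
  have above: "point_above T (i, j) \<longleftrightarrow>
      (\<forall>x\<in>{1..k}. j \<le> x) \<or> (\<exists>i'<i. (i', j) \<in> P) \<or> (\<exists>j'. (j, j') \<in> P)" (is "_ \<longleftrightarrow> ?R")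
    if "(i, j) \<in> P" for i j
  proof
    assume "point_above T (i, j)"
    then obtain i' where i': "i' < i" "(i', j) \<in> ?Q" by (auto simp: point_above_def)
    consider "j < i'" | "j = i'" | "i' < j" by linarith
    then show ?R
    proof cases
      case 1 then show ?thesis using i' P by auto
    next
      case 2 then show ?thesis using i' diag by auto
    next
      case 3 then show ?thesis using sym[OF i'(2)] P by auto
    qed
  next
    have ij: "(i, j) \<in> ?Q" "j < i" using that P by auto
    assume ?R
    then consider "\<forall>x\<in>{1..k}. j \<le> x" | i' where "i' < i" "(i', j) \<in> P" | j' where "(j, j') \<in> P"
      by blast
    then show "point_above T (i, j)"
    proof cases
      case 1
      then have "j = 1" using k Q[OF ij(1)] by (auto intro: antisym)
      then show ?thesis using root ij(2) by (auto simp: point_above_def)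
    next
      case 2 then show ?thesis using P by (auto simp: point_above_def)
    next
      case 3
      then have "(j', j) \<in> ?Q" "j' < i" using P ij sym by auto
      then show ?thesis by (auto simp: point_above_def)
    qed
  qed
  have left: "point_left T (i, j) \<longleftrightarrow> (\<exists>j'<j. (i, j') \<in> P)" if "(i, j) \<in> P" for i j
    using that by (auto simp: point_left_def P)
  \<comment> \<open>Reflection exchanges "above" and "left", and the exclusive or is symmetric in
    them, so checking the points below the diagonal suffices.\<close>
  have swap: "point_above T (i, j) \<longleftrightarrow> point_left T (j, i)" for i j
    using sym by (auto simp: point_above_def point_left_def)
  have half: "(\<forall>c\<in>?Q - {(1, 1)}. point_above T c \<noteq> point_left T c) \<longleftrightarrow>
      (\<forall>i j. (i, j) \<in> P \<longrightarrow> point_above T (i, j) \<noteq> point_left T (i, j))" (is "?L \<longleftrightarrow> ?R")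
  proof
    show ?R if ?L using that P by auto
    assume r: ?R
    show ?L
    proof
      fix c assume c: "c \<in> ?Q - {(1, 1)}"
      obtain i j where ij: "c = (i, j)" by force
      consider "j < i" | "i = j" | "i < j" by linarith
      then show "point_above T c \<noteq> point_left T c"
      proof cases
        case 1 then show ?thesis using r c ij P by auto
      next
        case 2 then show ?thesis using diag c ij by auto
      next
        case 3
        then have "(j, i) \<in> P" using c ij sym P by auto
        then have "point_above T (j, i) \<noteq> point_left T (j, i)" using r by blast
        then show ?thesis unfolding ij swap[of j i] swap[of i j] by blast
      qed
    qed
  qed
  have least: "(\<forall>y\<in>{1..k}. x \<le> y) \<longleftrightarrow> x = 1" if "x \<in> {1..k}" for x
    using that k by (auto intro: antisym)
  have line: "(\<exists>y. (x, y) \<in> ?Q) \<longleftrightarrow> (\<forall>y\<in>{1..k}. x \<le> y) \<or> (\<exists>y. (x, y) \<in> P \<or> (y, x) \<in> P)"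
    if "x \<in> {1..k}" for x
    unfolding least[OF that]
  proof
    assume "\<exists>y. (x, y) \<in> ?Q"
    then obtain y where y: "(x, y) \<in> ?Q" by blast
    consider "y < x" | "x = y" | "x < y" by linarith
    then show "x = 1 \<or> (\<exists>y. (x, y) \<in> P \<or> (y, x) \<in> P)"
      using y sym diag unfolding P by cases auto
  next
    assume "x = 1 \<or> (\<exists>y. (x, y) \<in> P \<or> (y, x) \<in> P)"
    then show "\<exists>y. (x, y) \<in> ?Q" using root sym unfolding P by auto
  qed
  have lines: "(\<forall>(i, j)\<in>cells T. (\<exists>j'. (i, j') \<in> ?Q) \<and> (\<exists>i'. (i', j) \<in> ?Q)) \<longleftrightarrow>
      (\<forall>x\<in>{1..k}. (\<forall>y\<in>{1..k}. x \<le> y) \<or> (\<exists>y. (x, y) \<in> P \<or> (y, x) \<in> P))"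
  proof -
    \<comment> \<open>Over a full square the row condition and the column condition coincide by
      symmetry.\<close>
    have "(\<forall>(i, j)\<in>cells T. (\<exists>j'. (i, j') \<in> ?Q) \<and> (\<exists>i'. (i', j) \<in> ?Q)) \<longleftrightarrow>
        (\<forall>x\<in>{1..k}. \<exists>y. (x, y) \<in> ?Q)"
      unfolding cells using sym by blast
    then show ?thesis using line by simp
  qed
  have inside: "\<forall>i j. (i, j) \<in> P \<longrightarrow> i \<in> {1..k} \<and> j \<in> {1..k} \<and> j < i"
    using Q by (auto simp: P)
  have "tree_like_tableau T \<longleftrightarrow>
      (\<forall>c\<in>?Q - {(1, 1)}. point_above T c \<noteq> point_left T c) \<and>
      (\<forall>(i, j)\<in>cells T. (\<exists>j'. (i, j') \<in> ?Q) \<and> (\<exists>i'. (i', j) \<in> ?Q))"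
    using sub root ferrers_diagram_square[of k] by (auto simp: tree_like_tableau_def cells)
  also have "\<dots> \<longleftrightarrow> htab {1..k} P"
    unfolding half lines htab_def using inside above left by (auto simp del: atLeastAtMost_iff)
  finally show ?thesis .
qed

lemma shift_rows_half_points:
  "shift_rows (half_points T) = {(i, j) \<in> points T. j < i}"
proof (intro set_eqI iffI)
  fix p assume "p \<in> {(i, j) \<in> points T. j < i}"
  then obtain i j where p: "p = (i, j)" "(i, j) \<in> points T" "j < i" by auto
  then obtain r where "i = Suc r" by (cases i) auto
  then show "p \<in> shift_rows (half_points T)" using p by (simp add: half_points_def)
qed (auto simp: half_points_def)

lemma square_symmetric_tableauxD:
  assumes "T \<in> square_symmetric_tableaux (2 * n + 1)"
  shows "tree_like_tableau T" "cells T = {1..n + 1} \<times> {1..n + 1}" "points T \<subseteq> cells T"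
    and "(1, 1) \<in> points T" "(i, j) \<in> points T \<Longrightarrow> (j, i) \<in> points T"
    and "(i, i) \<in> points T \<Longrightarrow> i = 1"
    and "half_points T \<in> half_tableaux n"
proof -
  show t: "tree_like_tableau T"
    using assms by (auto simp: square_symmetric_tableaux_def symmetric_tableau_def)
  obtain k where k: "cells T = {1..k} \<times> {1..k}"
    using assms by (auto simp: square_symmetric_tableaux_def square_shape_def)
  have "card (points T) = 2 * n + 1"
    using assms by (auto simp: square_symmetric_tableaux_def tableau_size_def)
  \<comment> \<open>The size fixes the side: \<open>2 * n + 2 = 2 * k\<close>.\<close>
  then have "k = n + 1" using card_points_square[OF t k] by simp
  then show cells: "cells T = {1..n + 1} \<times> {1..n + 1}" using k by simp
  show sub: "points T \<subseteq> cells T" and root: "(1, 1) \<in> points T"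
    using t by (auto simp: tree_like_tableau_def)
  have sym: "(j, i) \<in> points T" if "(i, j) \<in> points T" for i j
    using assms that
    by (auto simp: square_symmetric_tableaux_def symmetric_tableau_def swap_image_eq_iff)
  then show "(i, j) \<in> points T \<Longrightarrow> (j, i) \<in> points T" .
  have diag: "i = 1" if "(i, i) \<in> points T" for i
  proof (rule ccontr)
    assume "i \<noteq> 1"
    \<comment> \<open>On the diagonal, symmetry makes "above" and "left" equivalent, so the
      exclusive or must fail there.\<close>
    then have "point_above T (i, i) \<noteq> point_left T (i, i)"
      using t that unfolding tree_like_tableau_def by blast
    then show False using sym by (auto simp: point_above_def point_left_def)
  qed
  then show "(i, i) \<in> points T \<Longrightarrow> i = 1" .
  show "half_points T \<in> half_tableaux n"
    unfolding half_tableaux_def mem_Collect_eq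
    using tree_like_iff_htab[OF cells sub root sym diag shift_rows_half_points] t
    by simp
qed

text \<open>The points above the diagonal are reflections of those below, and the only diagonal
  point is the root, so the lower half determines the tableau and can be completed to one.\<close>

lemma bij_betw_half_points:
  "bij_betw half_points (square_symmetric_tableaux (2 * n + 1)) (half_tableaux n)"
  unfolding bij_betw_def
proof (rule conjI, rule inj_onI)
  fix T1 T2
  assume T1: "T1 \<in> square_symmetric_tableaux (2 * n + 1)"
    and T2: "T2 \<in> square_symmetric_tableaux (2 * n + 1)"
    and eq: "half_points T1 = half_points T2"
  note D1 = square_symmetric_tableauxD[OF T1] and D2 = square_symmetric_tableauxD[OF T2]
  have "{(i, j) \<in> points T1. j < i} = {(i, j) \<in> points T2. j < i}"
    using eq by (simp flip: shift_rows_half_points)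
  then have lower: "(i, j) \<in> points T1 \<longleftrightarrow> (i, j) \<in> points T2" if "j < i" for i j
    using that by auto
  have "(i, j) \<in> points T1 \<longleftrightarrow> (i, j) \<in> points T2" for i j
  proof -
    consider "j < i" | "i = j" | "i < j" by linarith
    then show ?thesis
    proof cases
      case 2 then show ?thesis using D1(4,6) D2(4,6) by blast
    next
      case 3 then show ?thesis using lower D1(5) D2(5) by blast
    qed (rule lower)
  qed
  then have "points T1 = points T2" by auto
  then show "T1 = T2" using D1(2) D2(2) by (simp add: tableau.expand)
next
  show "half_points ` square_symmetric_tableaux (2 * n + 1) = half_tableaux n"
  proof (intro equalityI subsetI)
    fix H assume H: "H \<in> half_tableaux n"
    let ?P = "shift_rows H"
    have h: "htab {1..n + 1} ?P" using H by (simp add: half_tableaux_def)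
    \<comment> \<open>The completion: the root, the given points and their mirror images.\<close>
    define T where "T = Tableau ({1..n + 1} \<times> {1..n + 1}) ({(1, 1)} \<union> ?P \<union> prod.swap ` ?P)"
    have cells: "cells T = {1..n + 1} \<times> {1..n + 1}" by (simp add: T_def)
    have mem: "(i, j) \<in> points T \<longleftrightarrow> i = 1 \<and> j = 1 \<or> (i, j) \<in> ?P \<or> (j, i) \<in> ?P" for i j
      by (force simp: T_def image_iff)
    have sub: "points T \<subseteq> cells T"
      unfolding cells using htabD(1,2)[OF h] mem by force
    have root: "(1, 1) \<in> points T" by (simp add: mem)
    have sym: "(j, i) \<in> points T" if "(i, j) \<in> points T" for i j using that mem by auto
    have diag: "i = 1" if "(i, i) \<in> points T" for i
      using that htabD(3)[OF h, of i i] unfolding mem by auto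
    have lower: "?P = {(i, j) \<in> points T. j < i}"
    proof (intro set_eqI iffI)
      fix p assume "p \<in> {(i, j) \<in> points T. j < i}"
      then obtain i j where "p = (i, j)" "(i, j) \<in> points T" "j < i" by blast
      then show "p \<in> ?P" using htabD(3)[OF h, of j i] unfolding mem by auto
    next
      fix p assume "p \<in> ?P"
      then obtain i j where "p = (i, j)" "(i, j) \<in> ?P" by (metis surj_pair)
      then show "p \<in> {(i, j) \<in> points T. j < i}" using htabD(3)[OF h, of i j] mem by blast
    qed
    have t: "tree_like_tableau T"
      using tree_like_iff_htab[OF cells sub root sym diag lower] h by simp
    moreover have "card (points T) = 2 * n + 1" using card_points_square[OF t cells] by simp
    moreover have "square_shape T" using cells by (auto simp: square_shape_def)
    ultimately have "T \<in> square_symmetric_tableaux (2 * n + 1)"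
      using sym cells
      by (auto simp: square_symmetric_tableaux_def symmetric_tableau_def tableau_size_def
          swap_image_eq_iff)
    moreover have "half_points T = H"
      using trans[OF shift_rows_half_points lower[symmetric]]
      by (rule iffD1[OF inj_shift_rows])
    ultimately show "H \<in> half_points ` square_symmetric_tableaux (2 * n + 1)" by blast
  qed (use square_symmetric_tableauxD(7) in blast)
qed

section \<open>Diagonal crossings and the number of blocks\<close>

text \<open>By symmetry a diagonal cell has a point above it iff it has one to its left.\<close>

lemma card_diagonal_crossings:
  assumes T: "T \<in> square_symmetric_tableaux (2 * n + 1)"
  shows "card (diagonal_crossings T) = card (fst ` half_points T)"
proof -
  note D = square_symmetric_tableauxD[OF T]
  have "diagonal_crossings T = (\<lambda>r. (Suc r, Suc r)) ` fst ` half_points T"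
  proof (intro set_eqI iffI)
    fix p assume "p \<in> diagonal_crossings T"
    then obtain i where i: "p = (i, i)" "crossing T (i, i)" by (auto simp: diagonal_crossings_def)
    then obtain j where j: "j < i" "(i, j) \<in> points T" by (auto simp: crossing_def point_left_def)
    then obtain r where "i = Suc r" by (cases i) auto
    then have "(r, j) \<in> half_points T" using j by (simp add: half_points_def)
    then show "p \<in> (\<lambda>r. (Suc r, Suc r)) ` fst ` half_points T"
      using i \<open>i = Suc r\<close> by force
  next
    fix p assume "p \<in> (\<lambda>r. (Suc r, Suc r)) ` fst ` half_points T"
    then obtain r c where r: "p = (Suc r, Suc r)" "(r, c) \<in> half_points T" by auto
    then have c: "c \<le> r" "(Suc r, c) \<in> points T" by (auto simp: half_points_def)
    \<comment> \<open>Since \<open>1 \<le> c \<le> r\<close>, the diagonal cell in row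
      \<open>Suc r\<close> is not the root and is therefore empty.\<close>
    then have "1 \<le> c" "Suc r \<le> n + 1" using D(2,3) by auto
    then have "(Suc r, Suc r) \<in> cells T - points T" using D(2) D(6)[of "Suc r"] c by auto
    moreover have "point_left T (Suc r, Suc r)" "point_above T (Suc r, Suc r)"
      using c D(5)[OF c(2)] by (auto simp: point_left_def point_above_def less_Suc_eq_le)
    ultimately show "p \<in> diagonal_crossings T"
      using r(1) by (simp add: diagonal_crossings_def crossing_def)
  qed
  then show ?thesis by (simp add: card_image inj_on_def)
qed

theorem theorem3p10:
  fixes n :: nat
  shows "bij_betw Xi (square_symmetric_tableaux (2 * n + 1)) (ordered_partitions n) \<and>
    (\<forall>T \<in> square_symmetric_tableaux (2 * n + 1). \<forall>j.
       card (diagonal_crossings T) = j \<longrightarrow> length (Xi T) = j)"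
proof -
  \<comment> \<open>Size \<open>2 * n + 1\<close> makes the argument
    \<open>(tableau_size T - 1) div 2\<close> equal to \<open>n\<close>.\<close>
  have Xi: "Xi T = half_Xi n (half_points T)" if "T \<in> square_symmetric_tableaux (2 * n + 1)" for T
    using that by (simp add: Xi_def square_symmetric_tableaux_def)
  have "bij_betw (half_Xi n \<circ> half_points) (square_symmetric_tableaux (2 * n + 1))
      (block_lists {1..n})"
    using bij_betw_trans[OF bij_betw_half_points] half_Xi_correct by blast
  then have "bij_betw Xi (square_symmetric_tableaux (2 * n + 1)) (ordered_partitions n)"
    by (subst bij_betw_cong[where g = "half_Xi n \<circ> half_points"])
      (simp_all add: Xi ordered_partitions_def block_lists_def)
  moreover have "length (Xi T) = card (diagonal_crossings T)"
    if "T \<in> square_symmetric_tableaux (2 * n + 1)" for T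
    using half_Xi_correct[of n] square_symmetric_tableauxD(7)[OF that]
    by (simp add: Xi[OF that] card_diagonal_crossings[OF that])
  ultimately show ?thesis by simp
qed

end
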